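(* Let $N,n\ge 1$ be integers. For each $i\in\{1,\dots,N\}$ let $\mathcal X^i\subseteq\mathbb R^n$ be non-empty, compact and convex, and let $f_\circ^i$ be a function on $\mathbb R^n$ with values in $\mathbb R\cup\{+\infty\}$ such that $f^i:=f_\circ^i+\iota_{\mathcal X^i}:\mathbb R^n\to\mathbb R\cup\{+\infty\}$ is proper, lower semi-continuous and convex. Let $P=[a_{i,j}]\in\mathbb R^{N\times N}$ be a row-stochastic matrix ($a_{i,j}\ge 0$ for all $i,j$ and $\sum_{j=1}^N a_{i,j}=1$ for all $i$) with $\min_{i} a_{i,i}>0$ and such that the associated weighted digraph is strongly connected. Put $\boldsymbol A:=P\otimes I_n$, $\mathcal X:=\mathcal X^1\times\cdots\times\mathcal X^N$ and $\boldsymbol f(\boldsymbol x):=\sum_{i=1}^N f^i(x^i)$. Then there exists a symmetric positive definite matrix $\tilde{\boldsymbol Q}\in\mathbb R^{nN\times nN}$ such that, for every $\boldsymbol x(0)\in\mathcal X$, the sequence $(\boldsymbol x(k))_{k=0}^\infty$ generated by $$\boldsymbol x(k+1)=\mathrm{prox}_{\boldsymbol f}^{\tilde{\boldsymbol Q}}\big(\boldsymbol A\,\boldsymbol x(k)\big),\qquad k\in\mathbb N,$$ converges to a network equilibrium, i.e. to a point of $\mathrm{fix}\big(\mathrm{prox}_{\boldsymbol f}^{\tilde{\boldsymbol Q}}\circ\boldsymbol A\big)$.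
   Context: Collective vectors are written $\boldsymbol x=[x^1;\dots;x^N]\in\mathbb R^{nN}$ with $x^i\in\mathbb R^n$. $\iota_{\mathcal C}$ is the indicator function ($0$ on $\mathcal C$, $+\infty$ elsewhere). For a symmetric positive definite matrix $Q$, $\|x\|_Q:=\sqrt{x^\top Qx}$, and for a proper lower semi-continuous convex function $f$, $\mathrm{prox}_f^Q(x):=\mathrm{argmin}_y\, f(y)+\tfrac12\|x-y\|_Q^2$ (a single point). $\mathrm{fix}(T)$ denotes the set of fixed points of a map $T$. $\otimes$ is the Kronecker product. The weighted digraph associated with $P$ has nodes $1,\dots,N$, with an edge between $i$ and $j$ (in a fixed direction convention) exactly when $a_{i,j}\ne 0$. If $\boldsymbol Q=\mathrm{diag}(Q_1,\dots,Q_N)$ is block-diagonal with $n\times n$ blocks $Q_i\succ 0$, then $\mathrm{prox}_{\boldsymbol f}^{\boldsymbol Q}(\boldsymbol z)=[\mathrm{prox}_{f^1}^{Q_1}(z^1);\dots;\mathrm{prox}_{f^N}^{Q_N}(z^N)]$. In that case $\overline{\boldsymbol x}$ is a fixed point of $\mathrm{prox}_{\boldsymbol f}^{\boldsymbol Q}\circ\boldsymbol A$ if and only if $\overline x^i\in\mathrm{argmin}_{y\in\mathcal X^i} f_\circ^i(y)+\tfrac12\|y-\sum_{j=1}^N a_{i,j}\overline x^j\|_{Q_i}^2$ for every $i$, which is the definition of a network equilibrium. For general $\boldsymbol Q\succ0$, a network equilibrium is understood as a point of $\mathrm{fix}(\mathrm{prox}_{\boldsymbol f}^{\boldsymbol Q}\circ\boldsymbol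 A)$. *)

theory Defs
  imports "HOL-Analysis.Analysis" "Graph_Theory.Pair_Digraph" "Graph_Theory.Digraph_Component"
begin

(* The collective space R^(nN) is real ^ ('N \<times> 'n): coordinate (i, k) of a collective vector is
   coordinate k of its i-th block, so that the Kronecker product of an 'N-matrix and an 'n-matrix
   acts on it without re-indexing. *)

definition block :: "'N \<Rightarrow> real ^ ('N::finite \<times> 'n::finite) \<Rightarrow> real ^ 'n" where
  "block i x = (\<chi> k. x $ (i, k))"

definition kronecker :: "real ^ 'b ^ 'a \<Rightarrow> real ^ 'd ^ 'c \<Rightarrow>
    real ^ ('b::finite \<times> 'd::finite) ^ ('a::finite \<times> 'c::finite)" where
  "kronecker P M = (\<chi> r s. P $ fst r $ fst s * M $ snd r $ snd s)"

definition row_stochastic :: "real ^ 'N ^ 'N \<Rightarrow> bool" where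
  "row_stochastic P \<longleftrightarrow> (\<forall>i j. 0 \<le> P $ i $ j) \<and> (\<forall>i. (\<Sum>j\<in>UNIV. P $ i $ j) = 1)"

definition matrix_digraph :: "real ^ 'N ^ 'N \<Rightarrow> 'N pair_pre_digraph" where
  "matrix_digraph P = \<lparr> pverts = UNIV, parcs = {(i, j). P $ i $ j \<noteq> 0} \<rparr>"

definition sym_pos_def :: "real ^ 'm ^ 'm \<Rightarrow> bool" where
  "sym_pos_def Q \<longleftrightarrow> transpose Q = Q \<and> (\<forall>x. x \<noteq> 0 \<longrightarrow> 0 < x \<bullet> (Q *v x))"

definition norm_wrt :: "real ^ 'm ^ 'm \<Rightarrow> real ^ 'm \<Rightarrow> real" where
  "norm_wrt Q x = sqrt (x \<bullet> (Q *v x))"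

definition indicator_ereal :: "'a set \<Rightarrow> 'a \<Rightarrow> ereal" where
  "indicator_ereal C x = (if x \<in> C then 0 else \<infinity>)"

definition proper :: "('a \<Rightarrow> ereal) \<Rightarrow> bool" where
  "proper f \<longleftrightarrow> (\<forall>x. f x \<noteq> - \<infinity>) \<and> (\<exists>x. f x \<noteq> \<infinity>)"

definition lower_semicontinuous :: "('a::topological_space \<Rightarrow> ereal) \<Rightarrow> bool" where
  "lower_semicontinuous f \<longleftrightarrow> (\<forall>x. f x \<le> Liminf (at x) f)"

(* Only used together with proper, so that the right-hand side is never \<infinity> - \<infinity>. *)
definition convex_ereal :: "('a::real_vector \<Rightarrow> ereal) \<Rightarrow> bool" where
  "convex_ereal f \<longleftrightarrow> (\<forall>x y t. 0 < t \<and> t < 1 \<longrightarrow>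
     f ((1 - t) *\<^sub>R x + t *\<^sub>R y) \<le> ereal (1 - t) * f x + ereal t * f y)"

(* The minimizer exists and is unique when f is proper, lower semicontinuous and convex and Q is
   symmetric positive definite; otherwise the value may be arbitrary. *)
definition prox :: "real ^ 'm ^ 'm \<Rightarrow> (real ^ 'm \<Rightarrow> ereal) \<Rightarrow> real ^ 'm \<Rightarrow> real ^ 'm" where
  "prox Q f x = (THE y. is_arg_min (\<lambda>y. f y + ereal (1 / 2 * (norm_wrt Q (x - y))\<^sup>2)) (\<lambda>_. True) y)"

definition fix_points :: "('a \<Rightarrow> 'a) \<Rightarrow> 'a set" where
  "fix_points T = {x. T x = x}"

definition collective_cost :: "('N \<Rightarrow> real ^ 'n \<Rightarrow> ereal) \<Rightarrow> real ^ ('N::finite \<times> 'n::finite) \<Rightarrow> ereal" where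
  "collective_cost f x = (\<Sum>i\<in>UNIV. f i (block i x))"

definition collective_set :: "('N \<Rightarrow> (real ^ 'n) set) \<Rightarrow> (real ^ ('N::finite \<times> 'n::finite)) set" where
  "collective_set X = {x. \<forall>i. block i x \<in> X i}"

end

theory Submission
  imports Defs
begin

text \<open>Let \<open>q > 0\<close> be the left Perron vector of \<open>P\<close>, whose positivity is where strong connectivity
  enters, and take \<open>Q = diag(q) \<otimes> I\<close>. Jensen's inequality with the variance as remainder gives
  \<open>\<parallel>A z\<parallel>\<^sup>2 \<le> \<parallel>z\<parallel>\<^sup>2 - c \<parallel>z - A z\<parallel>\<^sup>2\<close> in the norm of \<open>Q\<close>, with \<open>c\<close> the smallest diagonal entry of \<open>P\<close>.
  The proximal map is firmly nonexpansive in the same norm, so for \<open>T = prox \<circ> A\<close> the distance of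
  the iterates to every fixed point decreases, and the residuals \<open>x k - T (x k)\<close> tend to \<open>0\<close>. By
  Brouwer a fixed point exists, by compactness a subsequence converges, its limit is a fixed point,
  and monotonicity of the distance to that limit gives convergence of the whole sequence.\<close>

subsection \<open>Lower semicontinuous and convex functions\<close>

text \<open>Open superlevel sets are the form that passes to preimages, sums and finite subcovers.
  The \<open>Liminf\<close> ignores the point itself, where \<open>c < f x\<close> is given.\<close>

lemma lower_semicontinuous_iff_open:
  "lower_semicontinuous f \<longleftrightarrow> (\<forall>c. open {x. c < f x})"
proof
  assume lsc: "lower_semicontinuous f"
  show "\<forall>c. open {x. c < f x}"
  proof
    fix c
    have "\<forall>\<^sub>F y in nhds x. c < f y" if "c < f x" for x
    proof -
      have "\<forall>\<^sub>F y in at x. c < f y"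
        using lsc that by (auto simp: lower_semicontinuous_def le_Liminf_iff)
      then show ?thesis
        using that by (auto simp: eventually_at_filter elim: eventually_mono)
    qed
    then show "open {x. c < f x}"
      by (subst open_subopen) (force simp: eventually_nhds)
  qed
next
  assume op: "\<forall>c. open {x. c < f x}"
  have "\<forall>\<^sub>F y in at x. c < f y" if "c < f x" for c x
    using topological_tendstoD[OF tendsto_ident_at op[rule_format, of c], of x UNIV] that by simp
  then show "lower_semicontinuous f"
    by (auto simp: lower_semicontinuous_def le_Liminf_iff)
qed

lemma lower_semicontinuous_compose:
  assumes "lower_semicontinuous f" "continuous_on UNIV g"
  shows "lower_semicontinuous (\<lambda>x. f (g x))"
  unfolding lower_semicontinuous_iff_open
proof
  fix c
  have "open (g -` {x. c < f x})"
    using assms by (intro open_vimage) (auto simp: lower_semicontinuous_iff_open)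
  then show "open {x. c < f (g x)}"
    by (simp add: vimage_def)
qed

lemma lower_semicontinuous_continuous:
  fixes g :: "'a::topological_space \<Rightarrow> real"
  assumes "continuous_on UNIV g"
  shows "lower_semicontinuous (\<lambda>x. ereal (g x))"
  unfolding lower_semicontinuous_iff_open
  by (intro allI open_Collect_less continuous_intros assms)

text \<open>For finite values, any real \<open>r\<close> strictly between \<open>c - G\<close> and
  \<open>F\<close> is a witness. A superlevel set of a sum thus becomes a union of intersections of
  superlevel sets of the summands.\<close>

lemma ereal_less_add_iff:
  fixes c F G :: ereal
  assumes "F \<noteq> - \<infinity>" "G \<noteq> - \<infinity>" "c \<noteq> \<infinity>"
  shows "c < F + G \<longleftrightarrow> (\<exists>r. ereal r < F \<and> c - ereal r < G)"
proof
  assume less: "c < F + G"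
  show "\<exists>r. ereal r < F \<and> c - ereal r < G"
  proof (cases c)
    case (real c')
    show ?thesis
    proof (cases F; cases G)
      fix f' g' assume F: "F = ereal f'" and G: "G = ereal g'"
      then have "c' - g' < f'"
        using less real by simp
      then obtain r where "c' - g' < r" "r < f'"
        using dense by blast
      then show ?thesis
        using F G real by (auto intro!: exI[of _ r])
    next
      fix f' assume "F = ereal f'" "G = \<infinity>"
      then show ?thesis
        using real by (auto intro!: exI[of _ "f' - 1"])
    next
      fix g' assume "F = \<infinity>" "G = ereal g'"
      then show ?thesis
        using real by (auto intro!: exI[of _ "c' - g' + 1"])
    qed (use assms real in auto)
  next
    case MInf
    then show ?thesis
      using assms by (cases F; cases G) (auto intro: lt_ex)
  qed (use assms in auto)
qed (use assms in \<open>cases c; cases F; cases G; auto\<close>)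

lemma lower_semicontinuous_add:
  assumes "lower_semicontinuous f" "lower_semicontinuous g"
    and "\<And>x. f x \<noteq> - \<infinity>" "\<And>x. g x \<noteq> - \<infinity>"
  shows "lower_semicontinuous (\<lambda>x. f x + g x)"
  unfolding lower_semicontinuous_iff_open
proof
  fix c
  show "open {x. c < f x + g x}"
  proof (cases "c = \<infinity>")
    case False
    then have "{x. c < f x + g x} = (\<Union>r. {x. ereal r < f x} \<inter> {x. c - ereal r < g x})"
      using ereal_less_add_iff assms(3,4) by auto
    then show ?thesis
      using assms(1,2) by (simp add: lower_semicontinuous_iff_open) blast
  qed simp
qed

text \<open>Without a minimum, the open sets \<open>{x. f y < f x}\<close> with \<open>y\<close> in
  \<open>K\<close> would cover \<open>K\<close>. The center \<open>y\<close> of least value in a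
  finite subcover lies in one of its sets, so another center has a smaller value.\<close>

lemma lower_semicontinuous_attains_min:
  fixes f :: "'a::topological_space \<Rightarrow> ereal"
  assumes "lower_semicontinuous f" "compact K" "K \<noteq> {}"
  obtains x where "x \<in> K" "\<And>y. y \<in> K \<Longrightarrow> f x \<le> f y"
proof -
  have "\<exists>x\<in>K. \<forall>y\<in>K. f x \<le> f y"
  proof (rule ccontr)
    assume "\<not> (\<exists>x\<in>K. \<forall>y\<in>K. f x \<le> f y)"
    then have less: "\<exists>y\<in>K. f y < f x" if "x \<in> K" for x
      using that by (meson not_le)
    have "K \<subseteq> (\<Union>y\<in>K. {x. f y < f x})"
      using less by auto
    moreover have "open {x. f y < f x}" for y
      using assms(1) by (simp add: lower_semicontinuous_iff_open)
    ultimately obtain C where C: "C \<subseteq> K" "finite C" "K \<subseteq> (\<Union>y\<in>C. {x. f y < f x})"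
      using compactE_image[OF assms(2), of K "\<lambda>y. {x. f y < f x}"] by metis
    then have "C \<noteq> {}"
      using assms(3) by auto
    then obtain y where y: "y \<in> C" "\<And>z. z \<in> C \<Longrightarrow> f y \<le> f z"
      using ex_is_arg_min_if_finite[OF C(2), of f] by (auto simp: is_arg_min_linorder)
    obtain z where "z \<in> C" "f z < f y"
      using C(1,3) y(1) by blast
    with y(2) show False
      by (simp add: not_less[symmetric])
  qed
  then show ?thesis
    using that by blast
qed

lemma convex_ereal_add:
  fixes f g :: "'a::real_vector \<Rightarrow> ereal"
  assumes "convex_ereal f" "convex_ereal g" "\<And>x. f x \<noteq> - \<infinity>" "\<And>x. g x \<noteq> - \<infinity>"
  shows "convex_ereal (\<lambda>x. f x + g x)"
  unfolding convex_ereal_def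
proof (intro allI impI, elim conjE)
  fix x y :: 'a and t :: real
  assume t: "0 < t" "t < 1"
  let ?z = "(1 - t) *\<^sub>R x + t *\<^sub>R y"
  have "f ?z + g ?z \<le> (ereal (1 - t) * f x + ereal t * f y) + (ereal (1 - t) * g x + ereal t * g y)"
    using assms(1,2) t by (intro add_mono) (auto simp: convex_ereal_def)
  also have "\<dots> = ereal (1 - t) * (f x + g x) + ereal t * (f y + g y)"
    using assms(3)[of x] assms(3)[of y] assms(4)[of x] assms(4)[of y] t
    by (cases "f x"; cases "f y"; cases "g x"; cases "g y") (auto simp: algebra_simps)
  finally show "f ?z + g ?z \<le> ereal (1 - t) * (f x + g x) + ereal t * (f y + g y)" .
qed

subsection \<open>Proximal maps in a weighted inner product\<close>

lemma sym_pos_def_commute: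
  assumes "sym_pos_def Q"
  shows "x \<bullet> (Q *v y) = y \<bullet> (Q *v x)"
  using assms by (metis dot_lmul_matrix inner_commute sym_pos_def_def vector_transpose_matrix)

lemma sym_pos_def_nonneg:
  assumes "sym_pos_def Q"
  shows "0 \<le> x \<bullet> (Q *v x)"
  using assms by (cases "x = 0") (auto simp: sym_pos_def_def less_imp_le)

lemma norm_wrt_power2:
  assumes "sym_pos_def Q"
  shows "(norm_wrt Q x)\<^sup>2 = x \<bullet> (Q *v x)"
  using sym_pos_def_nonneg[OF assms] by (simp add: norm_wrt_def)

lemma continuous_on_matrix_vector_mult [continuous_intros]:
  fixes Q :: "real ^ 'm ^ 'k"
  assumes "continuous_on S g"
  shows "continuous_on S (\<lambda>x. Q *v g x)"
  by (rule bounded_linear.continuous_on[OF matrix_vector_mul_bounded_linear assms])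

text \<open>The constant is the minimum of the quadratic form on the compact unit sphere;
  homogeneity of degree two extends the bound to all vectors.\<close>

lemma sym_pos_def_coercive:
  fixes Q :: "real ^ 'm ^ 'm"
  assumes "sym_pos_def Q"
  obtains c where "0 < c" "\<And>x. c * (norm x)\<^sup>2 \<le> x \<bullet> (Q *v x)"
proof -
  have "continuous_on (sphere (0 :: real ^ 'm) 1) (\<lambda>x. x \<bullet> (Q *v x))"
    by (intro continuous_intros)
  moreover have "axis undefined 1 \<in> sphere (0 :: real ^ 'm) 1"
    by simp
  ultimately obtain u where u: "u \<in> sphere (0 :: real ^ 'm) 1"
      "\<And>x. x \<in> sphere 0 1 \<Longrightarrow> u \<bullet> (Q *v u) \<le> x \<bullet> (Q *v x)"
    using continuous_attains_inf[OF compact_sphere] by blast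
  have "u \<bullet> (Q *v u) * (norm x)\<^sup>2 \<le> x \<bullet> (Q *v x)" for x
  proof (cases "x = 0")
    case False
    then have "u \<bullet> (Q *v u) \<le> (x /\<^sub>R norm x) \<bullet> (Q *v (x /\<^sub>R norm x))"
      by (intro u) simp
    also have "\<dots> = x \<bullet> (Q *v x) / (norm x)\<^sup>2"
      by (simp add: matrix_vector_mult_scaleR power2_eq_square divide_simps)
    finally show ?thesis
      using False by (simp add: field_simps)
  qed simp
  moreover have "u \<noteq> 0"
    using u(1) by auto
  then have "0 < u \<bullet> (Q *v u)"
    using assms by (simp add: sym_pos_def_def)
  ultimately show ?thesis
    using that by blast
qed

text \<open>\<open>K\<close> encloses the effective domain of \<open>g\<close>. Its compactness
  yields minimizers, and later convergent subsequences and the setting for Brouwer.\<close>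

locale prox_data =
  fixes Q :: "real ^ 'm ^ 'm" and g :: "real ^ 'm \<Rightarrow> ereal" and K :: "(real ^ 'm) set"
  assumes Q: "sym_pos_def Q"
    and proper: "proper g" and lsc: "lower_semicontinuous g" and conv: "convex_ereal g"
    and K: "compact K" "\<And>x. g x \<noteq> \<infinity> \<Longrightarrow> x \<in> K"
begin

definition ip :: "real ^ 'm \<Rightarrow> real ^ 'm \<Rightarrow> real" where
  "ip x y = x \<bullet> (Q *v y)"

definition obj :: "real ^ 'm \<Rightarrow> real ^ 'm \<Rightarrow> ereal" where
  "obj z y = g y + ereal (1 / 2 * (norm_wrt Q (z - y))\<^sup>2)"

lemma ip_simps:
  "ip (x + y) z = ip x z + ip y z" "ip (x - y) z = ip x z - ip y z"
  "ip z (x + y) = ip z x + ip z y" "ip z (x - y) = ip z x - ip z y"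
  "ip (r *\<^sub>R x) y = r * ip x y" "ip x (r *\<^sub>R y) = r * ip x y"
  by (simp_all add: ip_def algebra_simps inner_diff_left inner_diff_right matrix_vector_mult_scaleR
      matrix_vector_mult_diff_distrib matrix_vector_right_distrib)

lemma ip_zero [simp]: "ip x 0 = 0"
  by (simp add: ip_def)

lemma ip_commute: "ip x y = ip y x"
  unfolding ip_def by (rule sym_pos_def_commute[OF Q])

lemma ip_diff_square: "ip (u - v) (u - v) = ip u u - 2 * ip v u + ip v v"
  using ip_commute[of u v] by (simp add: ip_simps)

lemma ip_nonneg: "0 \<le> ip x x"
  unfolding ip_def by (rule sym_pos_def_nonneg[OF Q])

lemma obj_eq: "obj z y = g y + ereal (ip (z - y) (z - y) / 2)"
  by (simp add: obj_def norm_wrt_power2[OF Q] ip_def)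

lemma g_not_minf: "g x \<noteq> - \<infinity>"
  using proper by (simp add: proper_def)

text \<open>A minimizer over \<open>K\<close> is global because the objective is infinite outside
  \<open>K\<close>.\<close>

lemma ex_arg_min:
  obtains p where "is_arg_min (obj z) (\<lambda>_. True) p"
proof -
  obtain x0 where x0: "g x0 \<noteq> \<infinity>"
    using proper by (auto simp: proper_def)
  have "lower_semicontinuous (obj z)"
    unfolding obj_eq ip_def
    by (intro lower_semicontinuous_add lsc g_not_minf lower_semicontinuous_continuous continuous_intros)
      auto
  then obtain p where p: "p \<in> K" "\<And>y. y \<in> K \<Longrightarrow> obj z p \<le> obj z y"
    using lower_semicontinuous_attains_min K x0 by (metis empty_iff)
  have "obj z p \<le> obj z y" for y
  proof (cases "g y = \<infinity>")
    case True
    then show ?thesis by (simp add: obj_eq)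
  qed (use K p in auto)
  then show ?thesis
    using that by (auto simp: is_arg_min_linorder)
qed

lemma arg_min_finite:
  assumes "is_arg_min (obj z) (\<lambda>_. True) p"
  shows "\<bar>g p\<bar> \<noteq> \<infinity>"
proof -
  obtain x0 where "g x0 \<noteq> \<infinity>"
    using proper by (auto simp: proper_def)
  moreover have "obj z p \<le> obj z x0"
    using assms by (simp add: is_arg_min_linorder)
  ultimately show ?thesis
    using g_not_minf[of p] by (auto simp: obj_eq)
qed

text \<open>The first-order optimality condition, obtained by comparing \<open>p\<close> with \<open>p + t (y - p)\<close> for
  \<open>t \<rightarrow> 0\<close>.\<close>
lemma arg_min_variational:
  assumes p: "is_arg_min (obj z) (\<lambda>_. True) p"
  shows "g p + ereal (ip (y - p) (z - p)) \<le> g y"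
proof (cases "g y = \<infinity>")
  case False
  obtain a where a: "g p = ereal a"
    using arg_min_finite[OF p] by auto
  obtain b where b: "g y = ereal b"
    using False g_not_minf[of y] by (cases "g y") auto
  have ineq: "a + ip (y - p) (z - p) \<le> b + t * (ip (y - p) (y - p) / 2)" if t: "0 < t" "t < 1" for t
  proof -
    let ?w = "(1 - t) *\<^sub>R p + t *\<^sub>R y"
    have "g ?w \<le> ereal (1 - t) * g p + ereal t * g y"
      using conv t by (auto simp: convex_ereal_def)
    then have gw: "g ?w \<le> ereal ((1 - t) * a + t * b)"
      by (simp add: a b)
    have "obj z p \<le> obj z ?w"
      using p by (simp add: is_arg_min_linorder)
    also have "\<dots> \<le> ereal ((1 - t) * a + t * b) + ereal (ip (z - ?w) (z - ?w) / 2)"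
      unfolding obj_eq by (intro add_mono gw) simp
    finally have "a + ip (z - p) (z - p) / 2 \<le> (1 - t) * a + t * b + ip (z - ?w) (z - ?w) / 2"
      by (simp add: obj_eq a)
    moreover have "z - ?w = (z - p) - t *\<^sub>R (y - p)"
      by (simp add: algebra_simps)
    then have "ip (z - ?w) (z - ?w)
        = ip (z - p) (z - p) - 2 * t * ip (y - p) (z - p) + t * t * ip (y - p) (y - p)"
      by (simp only: ip_diff_square ip_simps(5,6) mult.assoc)
    \<comment> \<open>The terms free of \<open>t\<close> cancel, so a factor \<open>t\<close> can be
      divided out, leaving an error linear in \<open>t\<close>.\<close>
    ultimately have "t * (a + ip (y - p) (z - p)) \<le> t * (b + t * (ip (y - p) (y - p) / 2))"
      by (simp add: field_simps)
    then show ?thesis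
      using t by simp
  qed
  have "((\<lambda>t. b + t * (ip (y - p) (y - p) / 2)) \<longlongrightarrow> b + 0 * (ip (y - p) (y - p) / 2)) (at_right 0)"
    by (intro tendsto_intros)
  moreover have "\<forall>\<^sub>F t in at_right 0. a + ip (y - p) (z - p) \<le> b + t * (ip (y - p) (y - p) / 2)"
    using eventually_at_right_real[of 0 1] by (rule eventually_mono) (use ineq in auto)
  ultimately have "a + ip (y - p) (z - p) \<le> b + 0 * (ip (y - p) (y - p) / 2)"
    by (intro tendsto_lowerbound) auto
  then show ?thesis
    by (simp add: a b)
qed simp

text \<open>Each variational inequality is tested at the other minimizer; in their sum the finite
  values of \<open>g\<close> cancel.\<close>

lemma arg_min_firm:
  assumes p: "is_arg_min (obj z) (\<lambda>_. True) p" and p': "is_arg_min (obj z') (\<lambda>_. True) p'"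
  shows "ip (p - p') (p - p') \<le> ip (p - p') (z - z')"
proof -
  obtain a a' where "g p = ereal a" "g p' = ereal a'"
    using arg_min_finite[OF p] arg_min_finite[OF p'] by auto
  with arg_min_variational[OF p, of p'] arg_min_variational[OF p', of p]
  have "ip (p' - p) (z - p) + ip (p - p') (z' - p') \<le> 0"
    by simp
  then show ?thesis
    by (simp add: ip_simps)
qed

lemma ip_le_0_imp: "ip x x \<le> 0 \<Longrightarrow> x = 0"
  using Q by (force simp: sym_pos_def_def ip_def)

text \<open>Firmness with equal arguments forces two minimizers to coincide, so the
  \<open>THE\<close> in \<open>prox\<close> denotes one.\<close>

lemma prox_is_arg_min: "is_arg_min (obj z) (\<lambda>_. True) (prox Q g z)"
proof -
  obtain p where p: "is_arg_min (obj z) (\<lambda>_. True) p"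
    by (rule ex_arg_min)
  have "q = p" if "is_arg_min (obj z) (\<lambda>_. True) q" for q
    using arg_min_firm[OF that p] ip_le_0_imp[of "q - p"] by simp
  with p have "is_arg_min (obj z) (\<lambda>_. True) (THE q. is_arg_min (obj z) (\<lambda>_. True) q)"
    by (metis theI)
  then show ?thesis
    by (simp add: prox_def obj_def[abs_def])
qed

lemmas prox_firm = arg_min_firm[OF prox_is_arg_min prox_is_arg_min]

lemma prox_in: "prox Q g z \<in> K"
  by (rule K(2)) (use arg_min_finite[OF prox_is_arg_min[of z]] in auto)

text \<open>Firmness, Cauchy-Schwarz and coercivity of \<open>Q\<close> give a Lipschitz bound.
  Continuity serves both Brouwer and the passage to the limit along a subsequence.\<close>

lemma continuous_prox: "continuous_on UNIV (prox Q g)"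
proof -
  obtain c where c: "0 < c" "\<And>x. c * (norm x)\<^sup>2 \<le> x \<bullet> (Q *v x)"
    using sym_pos_def_coercive[OF Q] by blast
  have lip: "norm (prox Q g z - prox Q g z') \<le> norm (Q *v (z - z')) / c" for z z'
  proof -
    let ?d = "prox Q g z - prox Q g z'"
    have "c * (norm ?d)\<^sup>2 \<le> ?d \<bullet> (Q *v (z - z'))"
      using c(2)[of ?d] prox_firm[of z z'] by (simp add: ip_def)
    also have "\<dots> \<le> norm ?d * norm (Q *v (z - z'))"
      by (rule norm_cauchy_schwarz)
    finally have "norm ?d * (c * norm ?d) \<le> norm ?d * norm (Q *v (z - z'))"
      by (simp add: power2_eq_square mult_ac)
    then have "c * norm ?d \<le> norm (Q *v (z - z'))"
      by (cases "?d = 0") auto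
    then show ?thesis
      using c(1) by (simp add: field_simps)
  qed
  have "(prox Q g \<longlongrightarrow> prox Q g z) (at z)" for z
  proof -
    have "isCont (\<lambda>y. norm (Q *v (y - z)) / c) z"
      by (intro continuous_intros bounded_linear.isCont[OF matrix_vector_mul_bounded_linear])
        (use c in auto)
    then have "((\<lambda>y. norm (Q *v (y - z)) / c) \<longlongrightarrow> 0) (at z)"
      by (simp add: isCont_def)
    then have "((\<lambda>y. prox Q g y - prox Q g z) \<longlongrightarrow> 0) (at z)"
      by (rule Lim_null_comparison[rotated]) (simp add: lip)
    then show ?thesis
      by (simp add: LIM_zero_iff)
  qed
  then show ?thesis
    by (simp add: continuous_on_def)
qed

text \<open>The two residuals \<open>(x - A x) - (x\<^sup>* - A x\<^sup>*)\<close> and \<open>(A x - T x) - (A x\<^sup>* - x\<^sup>*)\<close> of one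
  step \<open>T = prox \<circ> A\<close> add up to \<open>x - T x\<close>, and each is paid for by a decrease of the distance to
  the fixed point \<open>x\<^sup>*\<close>.\<close>
lemma prox_iteration_converges:
  assumes A: "\<And>z. ip (A *v z) (A *v z) \<le> ip z z - c * ip (z - A *v z) (z - A *v z)" and c: "0 < c"
    and cvx: "convex K"
    and x0: "x 0 \<in> K" and x: "\<And>k. x (Suc k) = prox Q g (A *v x k)"
  shows "\<exists>xbar \<in> fix_points (prox Q g \<circ> (*v) A). x \<longlonglongrightarrow> xbar"
proof -
  define T where "T z = prox Q g (A *v z)" for z
  have T_cont: "continuous_on UNIV T"
    unfolding T_def
    by (rule continuous_on_compose2[OF continuous_prox]) (auto intro!: continuous_intros)
  have xT: "x (Suc k) = T (x k)" for k
    by (simp add: x T_def)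
  have xK: "x k \<in> K" for k
    using x0 by (cases k) (auto simp: x prox_in)
  \<comment> \<open>Brouwer applies on \<open>K\<close> itself: values of \<open>prox\<close> lie in
    \<open>K\<close>, and \<open>x 0\<close> shows that \<open>K\<close> is non-empty.\<close>
  obtain s where s: "T s = s"
  proof (rule brouwer[OF K(1) cvx])
    show "continuous_on K T"
      using T_cont continuous_on_subset by blast
  qed (use x0 in \<open>auto simp: T_def prox_in\<close>)
  define V where "V u z = ip (z - u) (z - u)" for u z
  define e where "e z u = (A *v z - T z) - (A *v u - u)" for z u :: "real ^ 'm"
  have step: "V u (T z) + ip (e z u) (e z u) + c * ip (z - u - A *v (z - u)) (z - u - A *v (z - u)) \<le> V u z"
    if u: "T u = u" for u z
  proof -
    have "V u (T z) \<le> ip (T z - u) (A *v (z - u))"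
      using prox_firm[of "A *v z" "A *v u"] u
      by (simp add: T_def V_def matrix_vector_mult_diff_distrib)
    moreover have "e z u = A *v (z - u) - (T z - u)"
      by (simp add: e_def matrix_vector_mult_diff_distrib)
    \<comment> \<open>Expanding the square of \<open>e z u\<close> gives the cross term -2
      \<open>ip (T z - u) (A *v (z - u))\<close>, which by firmness is at most -2
      \<open>V u (T z)\<close>.\<close>
    ultimately have "V u (T z) + ip (e z u) (e z u) \<le> ip (A *v (z - u)) (A *v (z - u))"
      by (simp only: V_def ip_diff_square)
    with A[of "z - u"] show ?thesis
      by (simp add: V_def)
  qed
  have decr: "V u (T z) \<le> V u z" if "T u = u" for u z
    using step[OF that, of z] ip_nonneg[of "e z u"] ip_nonneg[of "z - u - A *v (z - u)"] c
    by (smt (verit) mult_nonneg_nonneg)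
  have V_conv: "\<exists>l. (\<lambda>k. V u (x k)) \<longlonglongrightarrow> l" if "T u = u" for u
  proof -
    have "decseq (\<lambda>k. V u (x k))"
      by (intro decseq_SucI) (simp add: xT decr that)
    then show ?thesis
      using decseq_convergent[of "\<lambda>k. V u (x k)" 0] ip_nonneg by (metis V_def)
  qed
  \<comment> \<open>\<open>r k\<close> is the decrease of \<open>V s\<close> guaranteed in step
    \<open>k\<close>; it is squeezed between 0 and the difference of consecutive terms of a
    convergent sequence.\<close>
  define r where "r k = ip (e (x k) s) (e (x k) s)
    + c * ip (x k - s - A *v (x k - s)) (x k - s - A *v (x k - s))" for k
  obtain b where b: "0 < b" "\<And>x. b * (norm x)\<^sup>2 \<le> ip x x"
    using sym_pos_def_coercive[OF Q] unfolding ip_def by blast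
  have r_0: "r \<longlonglongrightarrow> 0"
  proof -
    obtain l where l: "(\<lambda>k. V s (x k)) \<longlonglongrightarrow> l"
      using V_conv[OF s] by blast
    then have "(\<lambda>k. V s (x k) - V s (x (Suc k))) \<longlonglongrightarrow> l - l"
      by (intro tendsto_diff LIMSEQ_Suc)
    moreover have "r k \<le> V s (x k) - V s (x (Suc k))" "0 \<le> r k" for k
      using step[OF s, of "x k"] ip_nonneg c by (auto simp: r_def xT)
    ultimately show ?thesis
      by (intro tendsto_sandwich[of "\<lambda>_. 0" r]) (auto intro: always_eventually)
  qed
  \<comment> \<open>Coercivity of \<open>Q\<close> turns convergence to 0 in the weighted norm into
    ordinary convergence.\<close>
  have null: "w \<longlonglongrightarrow> 0" if "(\<lambda>k. ip (w k) (w k)) \<longlonglongrightarrow> 0" for w :: "nat \<Rightarrow> real ^ 'm"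
  proof -
    have "(\<lambda>k. ip (w k) (w k) / b) \<longlonglongrightarrow> 0"
      using tendsto_divide[OF that tendsto_const[of b]] b by simp
    then have "(\<lambda>k. (norm (w k))\<^sup>2) \<longlonglongrightarrow> 0"
      by (rule Lim_null_comparison[rotated]) (use b in \<open>auto simp: field_simps\<close>)
    then show ?thesis
      using tendsto_norm_zero_iff power_tendsto_0_iff by fastforce
  qed
  have "(\<lambda>k. e (x k) s) \<longlonglongrightarrow> 0"
    by (rule null, rule Lim_null_comparison[OF _ r_0]) (use ip_nonneg c in \<open>simp add: r_def\<close>)
  moreover have "(\<lambda>k. x k - s - A *v (x k - s)) \<longlonglongrightarrow> 0"
  proof (rule null, rule Lim_null_comparison)
    show "(\<lambda>k. r k / c) \<longlonglongrightarrow> 0"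
      using tendsto_divide[OF r_0 tendsto_const[of c]] c by simp
  qed (use ip_nonneg c in \<open>simp add: r_def field_simps\<close>)
  ultimately have "(\<lambda>k. e (x k) s + (x k - s - A *v (x k - s))) \<longlonglongrightarrow> 0 + 0"
    by (intro tendsto_add)
  then have res: "(\<lambda>k. x k - T (x k)) \<longlonglongrightarrow> 0"
    by (simp add: e_def matrix_vector_mult_diff_distrib algebra_simps)
  obtain l \<rho> where l: "strict_mono \<rho>" "(x \<circ> \<rho>) \<longlonglongrightarrow> l"
    using K(1) xK unfolding compact_def by metis
  have "(\<lambda>k. (x \<circ> \<rho>) k - T ((x \<circ> \<rho>) k)) \<longlonglongrightarrow> l - T l"
    by (intro tendsto_diff l continuous_on_tendsto_compose[OF T_cont]) auto
  moreover have "(\<lambda>k. (x \<circ> \<rho>) k - T ((x \<circ> \<rho>) k)) \<longlonglongrightarrow> 0"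
    using LIMSEQ_subseq_LIMSEQ[OF res l(1)] by (simp add: o_def)
  ultimately have Tl: "T l = l"
    using LIMSEQ_unique by fastforce
  \<comment> \<open>As \<open>l\<close> is itself a fixed point, its distance to the whole sequence
    converges; the subsequence identifies the limit as 0.\<close>
  obtain m where m: "(\<lambda>k. V l (x k)) \<longlonglongrightarrow> m"
    using V_conv[OF Tl] by blast
  have "continuous_on UNIV (V l)"
    unfolding V_def ip_def by (intro continuous_intros)
  then have "(\<lambda>k. V l ((x \<circ> \<rho>) k)) \<longlonglongrightarrow> V l l"
    by (rule continuous_on_tendsto_compose[OF _ l(2)]) auto
  moreover have "(\<lambda>k. V l ((x \<circ> \<rho>) k)) \<longlonglongrightarrow> m"
    using LIMSEQ_subseq_LIMSEQ[OF m l(1)] by (simp add: o_def)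
  ultimately have "m = 0"
    using LIMSEQ_unique by (fastforce simp: V_def ip_def)
  then have "x \<longlonglongrightarrow> l"
    using null[of "\<lambda>k. x k - l"] m by (simp add: V_def LIM_zero_iff)
  moreover have "l \<in> fix_points (prox Q g \<circ> (*v) A)"
    using Tl by (simp add: fix_points_def T_def)
  ultimately show ?thesis
    by blast
qed

end

subsection \<open>The stationary distribution of an irreducible stochastic matrix\<close>

text \<open>The all-ones vector makes \<open>P - mat 1\<close> singular, hence its transpose too,
  which gives a left eigenvector \<open>v\<close>. Its entrywise absolute value is the required
  \<open>q\<close>.\<close>

lemma row_stochastic_invariant_nonneg:
  fixes P :: "real ^ 'N ^ 'N"
  assumes P: "row_stochastic P"
  obtains q where "q \<noteq> 0" "\<And>i. 0 \<le> q $ i" "\<And>j. (\<Sum>i\<in>UNIV. q $ i * P $ i $ j) = q $ j"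
proof -
  have nn: "0 \<le> P $ i $ j" and sum1: "(\<Sum>j\<in>UNIV. P $ i $ j) = 1" for i j
    using P by (auto simp: row_stochastic_def)
  have "(P - mat 1) *v 1 = 0"
    by (simp add: vec_eq_iff matrix_vector_mult_def mat_def sum_subtractf sum1)
  then have "\<nexists>B. B ** (P - mat 1) = mat 1"
    unfolding matrix_left_invertible_ker using one_neq_zero by blast
  then have "\<nexists>B. B ** transpose (P - mat 1) = mat 1"
    by (metis left_invertible_transpose matrix_left_right_inverse)
  then have "\<not> (\<forall>v. transpose (P - mat 1) *v v = 0 \<longrightarrow> v = 0)"
    by (simp add: matrix_left_invertible_ker)
  then obtain v where v: "transpose (P - mat 1) *v v = 0" "v \<noteq> 0"
    by blast
  have inv: "(\<Sum>i\<in>UNIV. v $ i * P $ i $ j) = v $ j" for j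
  proof -
    have "0 = (transpose (P - mat 1) *v v) $ j"
      using v by simp
    also have "\<dots> = (\<Sum>i\<in>UNIV. v $ i * P $ i $ j - (if i = j then v $ i else 0))"
      by (auto simp: matrix_vector_mult_def transpose_def mat_def algebra_simps intro!: sum.cong)
    also have "\<dots> = (\<Sum>i\<in>UNIV. v $ i * P $ i $ j) - v $ j"
      by (simp add: sum_subtractf)
    finally show ?thesis
      by simp
  qed
  have le: "\<bar>v $ j\<bar> \<le> (\<Sum>i\<in>UNIV. \<bar>v $ i\<bar> * P $ i $ j)" for j
    using sum_abs[of "\<lambda>i. v $ i * P $ i $ j" UNIV] nn by (simp add: inv abs_mult)
  have "(\<Sum>j\<in>UNIV. \<Sum>i\<in>UNIV. \<bar>v $ i\<bar> * P $ i $ j) = (\<Sum>i\<in>UNIV. \<bar>v $ i\<bar>)"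
    by (subst sum.swap) (simp add: sum1 flip: sum_distrib_left)
  \<comment> \<open>The entrywise inequality \<open>le\<close> has equal totals on both sides, so it
    is an equality in every entry.\<close>
  then have "(\<Sum>i\<in>UNIV. \<bar>v $ i\<bar> * P $ i $ j) = \<bar>v $ j\<bar>" for j
    using sum_mono_inv[of "\<lambda>j. \<bar>v $ j\<bar>" UNIV "\<lambda>j. \<Sum>i\<in>UNIV. \<bar>v $ i\<bar> * P $ i $ j" j] le
    by simp
  then show ?thesis
    using v(2) by (intro that[of "\<chi> i. \<bar>v $ i\<bar>"]) (simp_all add: vec_eq_iff)
qed

text \<open>Positivity spreads along arcs: invariance gives \<open>q $ k\<close> at least
  \<open>q $ j * P $ j $ k\<close>. Strong connectivity carries it from one positive entry to
  all.\<close>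

lemma row_stochastic_invariant_pos:
  fixes P :: "real ^ 'N ^ 'N"
  assumes P: "row_stochastic P" and sc: "strongly_connected (with_proj (matrix_digraph P))"
  obtains q where "\<And>i. 0 < q $ i" "\<And>j. (\<Sum>i\<in>UNIV. q $ i * P $ i $ j) = q $ j"
proof -
  obtain q where q: "q \<noteq> 0" "\<And>i. 0 \<le> q $ i" "\<And>j. (\<Sum>i\<in>UNIV. q $ i * P $ i $ j) = q $ j"
    using row_stochastic_invariant_nonneg[OF P] by blast
  obtain i where i: "0 < q $ i"
    using q(1,2) by (metis order_less_le vec_eq_iff zero_index)
  have "0 < q $ j" for j
  proof -
    have "i \<rightarrow>\<^sup>*\<^bsub>with_proj (matrix_digraph P)\<^esub> j"
      using sc by (auto simp: strongly_connected_def matrix_digraph_def)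
    then have "(i, j) \<in> (arcs_ends (with_proj (matrix_digraph P)))\<^sup>*"
      by (rule reachable_rtranclI)
    then show ?thesis
    proof induction
      case (step j k)
      then have "P $ j $ k \<noteq> 0"
        by (auto simp: arcs_ends_def arc_to_ends_def matrix_digraph_def)
      then have "0 < q $ j * P $ j $ k"
        using step P by (simp add: row_stochastic_def order_less_le)
      also have "\<dots> \<le> (\<Sum>i\<in>UNIV. q $ i * P $ i $ k)"
        using q(2) P by (intro member_le_sum) (auto simp: row_stochastic_def)
      finally show ?case
        by (simp add: q(3))
    qed (rule i)
  qed
  with q(3) show ?thesis
    using that by blast
qed

text \<open>Jensen's inequality for the square, with the variance as remainder: the variance of the
  \<open>i\<close>-th row is at least its diagonal term.\<close>
lemma row_stochastic_averaged:
  fixes P :: "real ^ 'N ^ 'N" and z :: "real ^ 'N"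
  assumes P: "row_stochastic P" and c: "\<And>i. c \<le> P $ i $ i"
    and q: "\<And>i. 0 \<le> q $ i" "\<And>j. (\<Sum>i\<in>UNIV. q $ i * P $ i $ j) = q $ j"
  shows "(\<Sum>i\<in>UNIV. q $ i * ((P *v z) $ i)\<^sup>2)
    \<le> (\<Sum>i\<in>UNIV. q $ i * (z $ i)\<^sup>2) - c * (\<Sum>i\<in>UNIV. q $ i * (z $ i - (P *v z) $ i)\<^sup>2)"
proof -
  have nn: "0 \<le> P $ i $ j" and sum1: "(\<Sum>j\<in>UNIV. P $ i $ j) = 1" for i j
    using P by (auto simp: row_stochastic_def)
  have row: "((P *v z) $ i)\<^sup>2 + c * (z $ i - (P *v z) $ i)\<^sup>2 \<le> (\<Sum>j\<in>UNIV. P $ i $ j * (z $ j)\<^sup>2)" for i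
  proof -
    define m where "m = (P *v z) $ i"
    have m: "(\<Sum>j\<in>UNIV. P $ i $ j * z $ j) = m"
      by (simp add: m_def matrix_vector_mult_def)
    have "c * (z $ i - m)\<^sup>2 \<le> P $ i $ i * (z $ i - m)\<^sup>2"
      using c by (simp add: mult_right_mono)
    also have "\<dots> \<le> (\<Sum>j\<in>UNIV. P $ i $ j * (z $ j - m)\<^sup>2)"
      by (rule member_le_sum[of i UNIV "\<lambda>j. P $ i $ j * (z $ j - m)\<^sup>2"]) (auto simp: nn)
    \<comment> \<open>Here \<open>m\<close> is the mean of \<open>z\<close> under row
      \<open>i\<close>, so the expansion is the usual formula for the variance.\<close>
    also have "\<dots> = (\<Sum>j\<in>UNIV. P $ i $ j * (z $ j)\<^sup>2 - 2 * m * (P $ i $ j * z $ j) + m\<^sup>2 * P $ i $ j)"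
      by (intro sum.cong) (auto simp: power2_eq_square algebra_simps)
    also have "\<dots> = (\<Sum>j\<in>UNIV. P $ i $ j * (z $ j)\<^sup>2) - m\<^sup>2"
      by (simp add: sum.distrib sum_subtractf m sum1 power2_eq_square flip: sum_distrib_left)
    finally show ?thesis
      by (simp add: m_def)
  qed
  have "(\<Sum>i\<in>UNIV. q $ i * (((P *v z) $ i)\<^sup>2 + c * (z $ i - (P *v z) $ i)\<^sup>2))
      \<le> (\<Sum>i\<in>UNIV. q $ i * (\<Sum>j\<in>UNIV. P $ i $ j * (z $ j)\<^sup>2))"
    by (intro sum_mono mult_left_mono row q)
  \<comment> \<open>After the exchange of sums, invariance of \<open>q\<close> collapses the inner
    sum to \<open>q $ j\<close>.\<close>
  also have "\<dots> = (\<Sum>j\<in>UNIV. (\<Sum>i\<in>UNIV. q $ i * P $ i $ j) * (z $ j)\<^sup>2)"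
    by (simp add: sum_distrib_left sum_distrib_right mult.assoc) (rule sum.swap)
  finally show ?thesis
    by (simp add: q(2) algebra_simps sum.distrib sum_distrib_left)
qed

subsection \<open>The collective problem\<close>

lemma block_add: "block i (x + y) = block i x + block i y"
  by (simp add: block_def vec_eq_iff)

lemma block_scaleR: "block i (r *\<^sub>R x) = r *\<^sub>R block i x"
  by (simp add: block_def vec_eq_iff)

lemma bounded_linear_block: "bounded_linear (block i)"
  by (intro linear_conv_bounded_linear[THEN iffD1] linearI block_add block_scaleR)

lemma collective_set_eq_INT: "collective_set X = (\<Inter>i. block i -` X i)"
  by (auto simp: collective_set_def)

lemma block_surj:
  obtains x :: "real ^ ('N::finite \<times> 'n::finite)" where "\<And>i. block i x = y i"
proof
  show "block i (\<chi> r. y (fst r) $ snd r) = y i" for i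
    by (simp add: block_def vec_eq_iff)
qed

lemma compact_collective_set:
  fixes X :: "'N::finite \<Rightarrow> (real ^ 'n::finite) set"
  assumes "\<And>i. compact (X i)"
  shows "compact (collective_set X)"
proof -
  have "closed (collective_set X)"
    unfolding collective_set_eq_INT
    by (intro closed_INT ballI closed_vimage compact_imp_closed assms linear_continuous_on
        bounded_linear_block)
  moreover have "bounded (collective_set X)"
  proof -
    have "\<exists>B. \<forall>x\<in>X i. norm x \<le> B" for i
      using compact_imp_bounded[OF assms] by (simp add: bounded_iff)
    then obtain B where B: "\<And>i x. x \<in> X i \<Longrightarrow> norm x \<le> B i"
      by metis
    \<comment> \<open>The norm is at most the sum of absolute coordinates, each bounded through its
      block.\<close>
    have "norm x \<le> (\<Sum>r\<in>(UNIV :: ('N \<times> 'n) set). B (fst r))" if "x \<in> collective_set X" for x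
    proof -
      have "\<bar>x $ r\<bar> \<le> B (fst r)" for r :: "'N \<times> 'n"
      proof -
        have "\<bar>block (fst r) x $ snd r\<bar> \<le> norm (block (fst r) x)"
          by (rule component_le_norm_cart)
        also have "\<dots> \<le> B (fst r)"
          using that by (intro B) (simp add: collective_set_def)
        finally have "\<bar>block (fst r) x $ snd r\<bar> \<le> B (fst r)" .
        then show ?thesis
          by (simp add: block_def)
      qed
      then have "(\<Sum>r\<in>UNIV. \<bar>x $ r\<bar>) \<le> (\<Sum>r\<in>(UNIV :: ('N \<times> 'n) set). B (fst r))"
        by (intro sum_mono) blast
      then show ?thesis
        by (rule order_trans[OF norm_le_l1_cart])
    qed
    then show ?thesis
      by (auto simp: bounded_iff)
  qed
  ultimately show ?thesis
    by (simp add: compact_eq_bounded_closed)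
qed

lemma convex_collective_set:
  assumes "\<And>i. convex (X i)"
  shows "convex (collective_set X)"
  unfolding collective_set_eq_INT
  by (intro convex_INT convex_linear_vimage bounded_linear.linear bounded_linear_block assms)

section \<open>Regularity of the separable cost\<close>

lemma sum_ereal_not_minf: "(\<And>i. i \<in> S \<Longrightarrow> h i \<noteq> - \<infinity>) \<Longrightarrow> (\<Sum>i\<in>S. h i) \<noteq> (- \<infinity> :: ereal)"
  by (induction S rule: infinite_finite_induct) auto

text \<open>Properness glues points of the effective domains into one collective vector. The other
  two properties follow by induction on the index set, the partial sums staying away from minus
  infinity.\<close>

lemma collective_cost_regular:
  fixes f :: "'N::finite \<Rightarrow> real ^ 'n::finite \<Rightarrow> ereal"
  assumes f: "\<And>i. proper (f i)" "\<And>i. lower_semicontinuous (f i)" "\<And>i. convex_ereal (f i)"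
  shows "proper (collective_cost f)" "lower_semicontinuous (collective_cost f)"
    "convex_ereal (collective_cost f)"
proof -
  have nm: "f i x \<noteq> - \<infinity>" for i x
    using f(1) by (simp add: proper_def)
  obtain y where y: "\<And>i. f i (y i) \<noteq> \<infinity>"
    using f(1) unfolding proper_def by metis
  obtain x :: "real ^ ('N \<times> 'n)" where "\<And>i. block i x = y i"
    using block_surj by blast
  then have "collective_cost f x \<noteq> \<infinity>"
    using y by (simp add: collective_cost_def sum_Pinfty)
  then show "proper (collective_cost f)"
    by (auto simp: proper_def collective_cost_def sum_ereal_not_minf nm)
  have lsc: "lower_semicontinuous (\<lambda>x. f i (block i x))" for i
    by (rule lower_semicontinuous_compose[OF f(2)])
      (intro linear_continuous_on bounded_linear_block)
  have conv: "convex_ereal (\<lambda>x. f i (block i x))" for i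
    using f(3)[of i] by (simp add: convex_ereal_def block_add block_scaleR)
  have "lower_semicontinuous (\<lambda>x. \<Sum>i\<in>S. f i (block i x)) \<and> convex_ereal (\<lambda>x. \<Sum>i\<in>S. f i (block i x))"
    if "finite S" for S
    using that
  proof induction
    case empty
    then show ?case
      by (simp add: lower_semicontinuous_iff_open convex_ereal_def)
  next
    case (insert i S)
    then show ?case
      by (auto intro!: lower_semicontinuous_add convex_ereal_add lsc conv nm sum_ereal_not_minf)
  qed
  then show "lower_semicontinuous (collective_cost f)" "convex_ereal (collective_cost f)"
    by (auto simp: collective_cost_def[abs_def])
qed

text \<open>\<open>A\<close> acts as \<open>P\<close> on each slice made of the \<open>k\<close>-th
  coordinates of all blocks, and the weights do not depend on \<open>k\<close>. The inequality is
  the scalar one summed over \<open>k\<close>.\<close>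

lemma kronecker_averaged:
  fixes P :: "real ^ 'N::finite ^ 'N" and z :: "real ^ ('N \<times> 'n::finite)"
  defines "A \<equiv> kronecker P (mat 1 :: real ^ 'n ^ 'n)"
  assumes P: "row_stochastic P" and c: "\<And>i. c \<le> P $ i $ i"
    and q: "\<And>i. 0 \<le> q $ i" "\<And>j. (\<Sum>i\<in>UNIV. q $ i * P $ i $ j) = q $ j"
  shows "(\<Sum>r\<in>UNIV. q $ fst r * ((A *v z) $ r)\<^sup>2)
    \<le> (\<Sum>r\<in>UNIV. q $ fst r * (z $ r)\<^sup>2) - c * (\<Sum>r\<in>UNIV. q $ fst r * ((z - A *v z) $ r)\<^sup>2)"
proof -
  define slice where "slice k w = (\<chi> i. w $ (i, k))" for k and w :: "real ^ ('N \<times> 'n)"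
  have slice_A: "slice k (A *v z) = P *v slice k z" for k
    unfolding vec_eq_iff
  proof
    fix i
    have "slice k (A *v z) $ i = (\<Sum>j\<in>UNIV. \<Sum>l\<in>UNIV. P $ i $ j * (mat 1 :: real ^ 'n ^ 'n) $ k $ l * z $ (j, l))"
      by (simp add: slice_def A_def matrix_vector_mult_def kronecker_def sum.cartesian_product
          flip: UNIV_Times_UNIV) (simp add: case_prod_beta)
    also have "\<dots> = (P *v slice k z) $ i"
      by (simp add: mat_def slice_def matrix_vector_mult_def if_distrib if_distribR cong: if_cong)
    finally show "slice k (A *v z) $ i = (P *v slice k z) $ i" .
  qed
  have split: "(\<Sum>r\<in>UNIV. q $ fst r * (w $ r)\<^sup>2) = (\<Sum>k\<in>UNIV. \<Sum>i\<in>UNIV. q $ i * (slice k w $ i)\<^sup>2)"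
    for w :: "real ^ ('N \<times> 'n)"
    by (subst sum.swap)
      (simp add: slice_def sum.cartesian_product case_prod_beta flip: UNIV_Times_UNIV)
  have "(\<Sum>k\<in>UNIV. \<Sum>i\<in>UNIV. q $ i * ((P *v slice k z) $ i)\<^sup>2)
    \<le> (\<Sum>k\<in>UNIV. (\<Sum>i\<in>UNIV. q $ i * (slice k z $ i)\<^sup>2)
        - c * (\<Sum>i\<in>UNIV. q $ i * (slice k z $ i - (P *v slice k z) $ i)\<^sup>2))"
    by (intro sum_mono row_stochastic_averaged P c q)
  moreover have "slice k (z - A *v z) $ i = slice k z $ i - (P *v slice k z) $ i" for k i
    unfolding slice_A[symmetric] by (simp add: slice_def)
  ultimately show ?thesis
    unfolding split by (simp add: slice_A sum_subtractf sum_distrib_left)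
qed

theorem lemma1:
  fixes X :: "'N::finite \<Rightarrow> (real ^ 'n::finite) set"
    and f\<^sub>0 :: "'N \<Rightarrow> real ^ 'n \<Rightarrow> ereal"
    and f :: "'N \<Rightarrow> real ^ 'n \<Rightarrow> ereal"
    and P :: "real ^ 'N ^ 'N"
    and A :: "real ^ ('N \<times> 'n) ^ ('N \<times> 'n)"
  assumes X: "\<And>i. X i \<noteq> {}" "\<And>i. compact (X i)" "\<And>i. convex (X i)"
    and f\<^sub>0: "\<And>i x. f\<^sub>0 i x \<noteq> - \<infinity>"
    and f_def: "f = (\<lambda>i x. f\<^sub>0 i x + indicator_ereal (X i) x)"
    and f: "\<And>i. proper (f i)" "\<And>i. lower_semicontinuous (f i)" "\<And>i. convex_ereal (f i)"
    and P: "row_stochastic P" "(MIN i. P $ i $ i) > 0"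
      "strongly_connected (with_proj (matrix_digraph P))"
    and A_def: "A = kronecker P (mat 1 :: real ^ 'n ^ 'n)"
  shows "\<exists>Q :: real ^ ('N \<times> 'n) ^ ('N \<times> 'n). sym_pos_def Q \<and>
    (\<forall>x :: nat \<Rightarrow> real ^ ('N \<times> 'n).
       x 0 \<in> collective_set X \<longrightarrow>
       (\<forall>k. x (Suc k) = prox Q (collective_cost f) (A *v x k)) \<longrightarrow>
       (\<exists>xbar \<in> fix_points (prox Q (collective_cost f) \<circ> (*v) A). x \<longlonglongrightarrow> xbar))"
proof -
  obtain q where q: "\<And>i. 0 < q $ i" "\<And>j. (\<Sum>i\<in>UNIV. q $ i * P $ i $ j) = q $ j"
    using row_stochastic_invariant_pos[OF P(1,3)] by blast
  \<comment> \<open>This is \<open>diag(q)\<close> tensored with the identity: the weight of agent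
    \<open>i\<close> is repeated on all coordinates of its block.\<close>
  define Q :: "real ^ ('N \<times> 'n) ^ ('N \<times> 'n)" where
    "Q = (\<chi> r s. if r = s then q $ fst r else 0)"
  have Qv: "(Q *v y) $ r = q $ fst r * y $ r" for y r
    by (simp add: Q_def matrix_vector_mult_def if_distribR if_distrib cong: if_cong)
  have quad: "y \<bullet> (Q *v y) = (\<Sum>r\<in>UNIV. q $ fst r * (y $ r)\<^sup>2)" for y
    by (simp add: inner_vec_def Qv power2_eq_square mult_ac)
  have Q: "sym_pos_def Q"
    unfolding sym_pos_def_def
  proof (intro conjI allI impI)
    show "transpose Q = Q"
      by (simp add: Q_def transpose_def vec_eq_iff)
    fix y :: "real ^ ('N \<times> 'n)"
    assume "y \<noteq> 0"
    then obtain r where "y $ r \<noteq> 0"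
      by (auto simp: vec_eq_iff)
    then show "0 < y \<bullet> (Q *v y)"
      unfolding quad using q(1)
      by (intro sum_pos2[of _ r]) (auto simp: less_imp_le)
  qed
  \<comment> \<open>A finite collective cost makes every indicator finite, so the compact product
    set can serve as \<open>K\<close>.\<close>
  interpret prox_data Q "collective_cost f" "collective_set X"
  proof
    fix x
    assume "collective_cost f x \<noteq> \<infinity>"
    then have "f i (block i x) \<noteq> \<infinity>" for i
      by (auto simp: collective_cost_def sum_Pinfty)
    then have "indicator_ereal (X i) (block i x) \<noteq> \<infinity>" for i
      using f\<^sub>0 by (auto simp: f_def)
    then have "block i x \<in> X i" for i
      by (metis indicator_ereal_def)
    then show "x \<in> collective_set X"
      by (simp add: collective_set_def)
  qed (intro Q collective_cost_regular f compact_collective_set X)+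
  \<comment> \<open>The least diagonal entry of \<open>P\<close> is the averaging constant, positive
    by assumption.\<close>
  have "ip (A *v z) (A *v z) \<le> ip z z - (MIN i. P $ i $ i) * ip (z - A *v z) (z - A *v z)" for z
    unfolding ip_def quad A_def
    by (intro kronecker_averaged P q less_imp_le[OF q(1)]) auto
  then show ?thesis
    using prox_iteration_converges[OF _ P(2) convex_collective_set[OF X(3)]] Q by blast
qed

end
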